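(* Let $n,p\ge 1$, let $X$ be a real $n\times p$ matrix, let $\iota_n\in\mathbb{R}^n$ be the vector of ones, and define $$\widehat{\mu}=\tfrac1n X'\iota_n\in\mathbb{R}^p,\qquad \widehat{\Sigma}=\tfrac1n X'\bigl(I_n-\tfrac1n\iota_n\iota_n'\bigr)X .$$ Let $\mathcal{C}\subseteq\mathbb{R}^p$ be a nonempty closed (not necessarily convex) cone such that $\lambda'\widehat{\Sigma}\lambda>0$ for all $\lambda\in\mathcal{C}\setminus\{0\}$, and let $\mathcal{S}^0=\{\lambda\in\mathbb{R}^p:\lambda'\widehat{\Sigma}\lambda=1\}\cup\{0\}$. Suppose that $$\widehat{\beta}=\arg\min_{\beta\in\mathcal{C}}\tfrac1n\|\iota_n-X\beta\|_2^2\qquad\text{and}\qquad \widehat{\lambda}=\arg\max_{\lambda\in\mathcal{S}^0\cap\mathcal{C}}\widehat{\mu}'\lambda$$ are unique optimizers (i.e. each optimization problem has exactly one optimizer, denoted $\widehat\beta$ and $\widehat\lambda$ respectively). Then $$\widehat{\lambda}=\frac{\widehat{\beta}}{\sqrt{\widehat{\beta}'\widehat{\Sigma}\widehat{\beta}}}\quad\text{if }\widehat{\beta}\neq 0,\qquad\text{and}\qquad \widehat{\lambda}=0\quad\text{otherwise.}$$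
   Context: A cone in $\mathbb{R}^p$ is a set $\mathcal{C}\subseteq\mathbb{R}^p$ closed under multiplication by positive scalars: if $\lambda\in\mathcal{C}$ then $\gamma\lambda\in\mathcal{C}$ for all $\gamma>0$. A prime denotes transpose, $I_n$ is the $n\times n$ identity matrix, and $\|\cdot\|_2$ is the Euclidean norm. Here $\widehat\mu$ is the sample mean and $\widehat\Sigma$ the sample covariance matrix of the data $X$. *)

theory Defs
  imports "HOL-Analysis.Analysis"
begin

text \<open>Cones are only required to be closed under strictly positive scaling, unlike
  \<^const>\<open>cone\<close> from the library, which forces a nonempty cone to contain the origin.\<close>

definition pos_cone :: "(real ^ 'p) set \<Rightarrow> bool" where
  "pos_cone C \<longleftrightarrow> (\<forall>x\<in>C. \<forall>c>0. c *\<^sub>R x \<in> C)"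

definition ones :: "real ^ 'n" where
  "ones = (\<chi> i. 1)"

definition sample_mean :: "real ^ 'p ^ 'n \<Rightarrow> real ^ 'p" where
  "sample_mean X = (1 / real CARD('n)) *\<^sub>R (transpose X *v ones)"

definition sample_cov :: "real ^ 'p ^ 'n \<Rightarrow> real ^ 'p ^ 'p" where
  "sample_cov X = (1 / real CARD('n)) *\<^sub>R
     (transpose X **
       (mat 1 - (1 / real CARD('n)) *\<^sub>R
         ((columnvector ones :: real ^ 1 ^ 'n) ** (rowvector ones :: real ^ 'n ^ 1))) ** X)"

definition quad_form :: "real ^ 'p ^ 'p \<Rightarrow> real ^ 'p \<Rightarrow> real" where
  "quad_form A x = x \<bullet> (A *v x)"

definition S0 :: "real ^ 'p ^ 'p \<Rightarrow> (real ^ 'p) set" where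
  "S0 A = {x. quad_form A x = 1} \<union> {0}"

definition ls_loss :: "real ^ 'p ^ 'n \<Rightarrow> real ^ 'p \<Rightarrow> real" where
  "ls_loss X b = (1 / real CARD('n)) * (norm (ones - X *v b))\<^sup>2"

end

theory Submission
  imports Defs
begin

text \<open>Write \<mu> for the sample mean and q for the quadratic form of the sample covariance. Since the
  second moment form is the covariance form plus the squared mean, the least squares loss is
  \<open>(1 - \<mu> \<bullet> b)\<^sup>2 + q b\<close> (\<open>ls_loss_eq\<close>). On the ray through a point u with \<open>q u = 1\<close> and \<open>t = \<mu> \<bullet> u > 0\<close>, the loss is
  \<open>(1 - a * t)\<^sup>2 + a\<^sup>2\<close> at \<open>a *\<^sub>R u\<close>; its minimum over a is \<open>1 / (1 + t\<^sup>2)\<close>, attained at \<open>a = t / (1 + t\<^sup>2)\<close>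
  (\<open>ray_loss_lower_bound\<close>, \<open>ray_loss_at_minimum\<close>).
  This is strictly decreasing in t and is below the loss 1 at the origin, so minimising the loss over
  the cone amounts to choosing a ray with the largest t, and staying at the origin if no ray has
  positive t. Hence the normalised (or zero) least squares solution maximises \<open>\<mu> \<bullet> \<lambda>\<close> over \<open>\<lambda>\<close> in
  \<open>S0 (sample_cov X) \<inter> C\<close>, and the uniqueness of that maximiser identifies it.\<close>

lemma pos_cone_closed_imp_0_mem:
  assumes "C \<noteq> {}" "closed C" "pos_cone C"
  shows "0 \<in> C"
proof -
  obtain x where x: "x \<in> C"
    using assms(1) by blast
  have "\<forall>k. inverse (real (Suc k)) *\<^sub>R x \<in> C"
    using assms(3) x by (auto simp: pos_cone_def)
  moreover have "(\<lambda>k. inverse (real (Suc k)) *\<^sub>R x) \<longlonglongrightarrow> 0 *\<^sub>R x"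
    by (intro tendsto_intros LIMSEQ_inverse_real_of_nat)
  ultimately show ?thesis
    using closed_sequentially[OF assms(2)] by fastforce
qed

lemma quad_form_scaleR: "quad_form A (c *\<^sub>R x) = c\<^sup>2 * quad_form A x"
  by (simp add: quad_form_def matrix_vector_mult_scaleR power2_eq_square)

lemma column_row_vector_mult:
  "(columnvector u :: real ^ 1 ^ 'n) ** (rowvector v :: real ^ 'm ^ 1) *v y = (v \<bullet> y) *\<^sub>R u"
  by (simp add: vec_eq_iff matrix_vector_mult_def matrix_matrix_mult_def columnvector_def
      rowvector_def inner_vec_def sum_distrib_left mult_ac)

lemma sample_mean_inner:
  fixes X :: "real ^ 'p ^ 'n"
  shows "sample_mean X \<bullet> b = (ones \<bullet> (X *v b)) / real CARD('n)"
  by (simp add: sample_mean_def transpose_matrix_vector dot_lmul_matrix)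

lemma quad_form_sample_cov:
  fixes X :: "real ^ 'p ^ 'n"
  shows "quad_form (sample_cov X) b
    = (norm (X *v b))\<^sup>2 / real CARD('n) - (sample_mean X \<bullet> b)\<^sup>2"
proof -
  let ?n = "real CARD('n)" and ?y = "X *v b"
  let ?J = "(columnvector ones :: real ^ 1 ^ 'n) ** (rowvector ones :: real ^ 'n ^ 1)"
  have "sample_cov X *v b
      = (1 / ?n) *\<^sub>R (transpose X *v ((mat 1 - (1 / ?n) *\<^sub>R ?J) *v ?y))"
    by (simp only: sample_cov_def scaleR_matrix_vector_assoc[symmetric]
        matrix_vector_mul_assoc matrix_mul_assoc)
  also have "(mat 1 - (1 / ?n) *\<^sub>R ?J) *v ?y = ?y - (1 / ?n) *\<^sub>R (ones \<bullet> ?y) *\<^sub>R ones"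
    by (simp only: matrix_vector_mult_diff_rdistrib matrix_vector_mul_lid
        scaleR_matrix_vector_assoc[symmetric] column_row_vector_mult)
  finally have "sample_cov X *v b = (1 / ?n) *\<^sub>R
      ((?y - (1 / ?n) *\<^sub>R (ones \<bullet> ?y) *\<^sub>R ones) v* X)"
    by (simp only: transpose_matrix_vector)
  then have "quad_form (sample_cov X) b
      = (1 / ?n) * ((?y - (1 / ?n) *\<^sub>R (ones \<bullet> ?y) *\<^sub>R ones) \<bullet> ?y)"
    by (simp add: quad_form_def inner_commute[of b] dot_lmul_matrix)
  then show ?thesis
    by (simp add: sample_mean_inner inner_diff_left power2_norm_eq_inner power_divide)
      (simp add: power2_eq_square field_simps)
qed

text \<open>Expanding the square leaves the second moment of the fitted values, which the previous
  lemma splits into covariance and squared mean; the latter completes a square in \<open>\<mu> \<bullet> b\<close>.\<close>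

lemma ls_loss_eq:
  fixes X :: "real ^ 'p ^ 'n"
  shows "ls_loss X b = (1 - sample_mean X \<bullet> b)\<^sup>2 + quad_form (sample_cov X) b"
proof -
  let ?n = "real CARD('n)" and ?y = "X *v b"
  have "(ones :: real ^ 'n) \<bullet> ones = ?n"
    by (simp add: ones_def inner_vec_def)
  then have "(norm (ones - ?y))\<^sup>2 = ?n - 2 * (ones \<bullet> ?y) + (norm ?y)\<^sup>2"
    by (simp add: power2_norm_eq_inner inner_diff_left inner_diff_right inner_commute)
  then have "ls_loss X b = 1 - 2 * (sample_mean X \<bullet> b) + (norm ?y)\<^sup>2 / ?n"
    by (simp add: ls_loss_def sample_mean_inner field_simps)
  then show ?thesis
    by (simp add: quad_form_sample_cov power2_diff)
qed

text \<open>This is Cauchy-Schwarz applied to \<open>1 = (1 - a * t) * 1 + a * t\<close>.\<close>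

lemma ray_loss_lower_bound:
  fixes a t :: real
  shows "1 / (1 + t\<^sup>2) \<le> (1 - a * t)\<^sup>2 + a\<^sup>2"
proof -
  have "((1 - a * t)\<^sup>2 + a\<^sup>2) * (1 + t\<^sup>2) = 1 + (t - a * (1 + t\<^sup>2))\<^sup>2"
    by (simp add: power2_eq_square algebra_simps)
  then have "1 \<le> ((1 - a * t)\<^sup>2 + a\<^sup>2) * (1 + t\<^sup>2)"
    by simp
  then show ?thesis
    by (simp add: divide_le_eq add_pos_nonneg)
qed

lemma ray_loss_at_minimum:
  fixes t :: real
  shows "(1 - t / (1 + t\<^sup>2) * t)\<^sup>2 + (t / (1 + t\<^sup>2))\<^sup>2 = 1 / (1 + t\<^sup>2)"
proof -
  have "1 + t\<^sup>2 \<noteq> 0"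
    by (metis add_pos_nonneg less_irrefl zero_le_power2 zero_less_one)
  then have "1 - t / (1 + t\<^sup>2) * t = 1 / (1 + t\<^sup>2)"
    by (simp add: field_simps power2_eq_square)
  then have "(1 - t / (1 + t\<^sup>2) * t)\<^sup>2 + (t / (1 + t\<^sup>2))\<^sup>2 = (1 + t\<^sup>2) / (1 + t\<^sup>2)\<^sup>2"
    by (simp add: power_divide add_divide_distrib)
  then show ?thesis
    by (simp add: power2_eq_square)
qed

text \<open>A positive mean makes x nonzero, so it is normalised, and the factor \<open>t / (1 + t\<^sup>2)\<close> is
  positive, so the loss minimiser of the ray through x lies in the cone and competes with \<open>\<beta>\<close>.\<close>

lemma ls_loss_minimum_le_of_pos_mean:
  assumes "pos_cone C" and "is_arg_min (ls_loss X) (\<lambda>b. b \<in> C) \<beta>"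
    and "x \<in> S0 (sample_cov X) \<inter> C" and "sample_mean X \<bullet> x > 0"
  shows "ls_loss X \<beta> \<le> 1 / (1 + (sample_mean X \<bullet> x)\<^sup>2)"
proof -
  define t where "t = sample_mean X \<bullet> x"
  define a where "a = t / (1 + t\<^sup>2)"
  have "x \<noteq> 0"
    using assms(4) by auto
  then have q: "quad_form (sample_cov X) x = 1"
    using assms(3) by (auto simp: S0_def)
  have "a > 0"
    using assms(4) by (auto simp: a_def t_def intro!: divide_pos_pos add_pos_nonneg)
  then have "a *\<^sub>R x \<in> C"
    using assms(1,3) by (auto simp: pos_cone_def)
  then have "ls_loss X \<beta> \<le> ls_loss X (a *\<^sub>R x)"
    using assms(2) by (auto simp: is_arg_min_def not_less)
  also have "\<dots> = (1 - a * t)\<^sup>2 + a\<^sup>2"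
    by (simp add: ls_loss_eq quad_form_scaleR q t_def)
  also have "\<dots> = 1 / (1 + t\<^sup>2)"
    unfolding a_def by (rule ray_loss_at_minimum)
  finally show ?thesis
    by (simp add: t_def)
qed

theorem proposition3:
  fixes X :: "real ^ 'p ^ 'n"
    and C :: "(real ^ 'p) set"
    and beta_hat lambda_hat :: "real ^ 'p"
  assumes "C \<noteq> {}" and "closed C" and "pos_cone C"
    and "\<forall>x \<in> C - {0}. quad_form (sample_cov X) x > 0"
    and "\<exists>!b. is_arg_min (ls_loss X) (\<lambda>b. b \<in> C) b"
    and "is_arg_min (ls_loss X) (\<lambda>b. b \<in> C) beta_hat"
    and "\<exists>!x. is_arg_max (\<lambda>x. sample_mean X \<bullet> x) (\<lambda>x. x \<in> S0 (sample_cov X) \<inter> C) x"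
    and "is_arg_max (\<lambda>x. sample_mean X \<bullet> x) (\<lambda>x. x \<in> S0 (sample_cov X) \<inter> C) lambda_hat"
  shows "(beta_hat \<noteq> 0 \<longrightarrow>
           lambda_hat = (1 / sqrt (quad_form (sample_cov X) beta_hat)) *\<^sub>R beta_hat)
       \<and> (beta_hat = 0 \<longrightarrow> lambda_hat = 0)"
proof (intro conjI impI)
  let ?m = "\<lambda>x. sample_mean X \<bullet> x" and ?q = "quad_form (sample_cov X)"
  let ?F = "S0 (sample_cov X) \<inter> C"
  have zero: "0 \<in> C"
    by (rule pos_cone_closed_imp_0_mem) fact+
  have loss_0: "ls_loss X 0 = 1"
    by (simp add: ls_loss_eq quad_form_def)
  have bound: "ls_loss X beta_hat \<le> 1 / (1 + (?m x)\<^sup>2)" if "x \<in> ?F" "?m x > 0" for x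
    using ls_loss_minimum_le_of_pos_mean assms(3,6) that .
  have unique: "lambda_hat = y" if "y \<in> ?F" "\<And>x. x \<in> ?F \<Longrightarrow> ?m x \<le> ?m y" for y
  proof -
    have "is_arg_max ?m (\<lambda>x. x \<in> ?F) y"
      using that by (auto simp: is_arg_max_def not_less)
    then show ?thesis
      using assms(7,8) by blast
  qed
  show "lambda_hat = 0" if "beta_hat = 0"
  proof (rule unique)
    show "0 \<in> ?F"
      using zero by (simp add: S0_def)
    show "?m x \<le> ?m 0" if "x \<in> ?F" for x
    proof (rule ccontr)
      assume "\<not> ?m x \<le> ?m 0"
      then have pos: "?m x > 0"
        by simp
      then have "1 / (1 + (?m x)\<^sup>2) < 1"
        by (simp add: divide_less_eq add_pos_nonneg)
      then show False
        using bound[OF that pos] loss_0 \<open>beta_hat = 0\<close> by simp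
    qed
  qed
  show "lambda_hat = (1 / sqrt (?q beta_hat)) *\<^sub>R beta_hat" if "beta_hat \<noteq> 0"
  proof (rule unique)
    define s where "s = sqrt (?q beta_hat)"
    define u where "u = (1 / s) *\<^sub>R beta_hat"
    have beta: "beta_hat \<in> C"
      using assms(6) by (simp add: is_arg_min_def)
    then have q_pos: "?q beta_hat > 0"
      using assms(4) that by simp
    then have s: "s > 0" "s\<^sup>2 = ?q beta_hat"
      by (simp_all add: s_def)
    have beta_u: "?m beta_hat = s * ?m u"
      using s(1) by (simp add: u_def)
    have "?q u = 1"
      using s q_pos by (simp add: u_def quad_form_scaleR power_divide)
    moreover have "u \<in> C"
      using assms(3) beta s(1) by (simp add: u_def pos_cone_def)
    ultimately show "(1 / sqrt (?q beta_hat)) *\<^sub>R beta_hat \<in> ?F"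
      by (simp add: S0_def u_def s_def)
    (* A nonpositive mean would put the loss above its value 1 at the origin, so the minimiser
       lies on a ray to which the comparison of minima 1 / (1 + t^2) applies. *)
    have "ls_loss X beta_hat \<le> 1"
      using assms(6) zero loss_0 by (force simp: is_arg_min_def not_less)
    then have "(1 - ?m beta_hat)\<^sup>2 < 1\<^sup>2"
      using q_pos by (simp add: ls_loss_eq)
    then have "?m beta_hat > 0"
      using power2_less_imp_less[of "1 - ?m beta_hat" 1] by simp
    then have u_pos: "?m u > 0"
      using s(1) beta_u by (simp add: zero_less_mult_iff)
    have "?m x \<le> ?m u" if "x \<in> ?F" for x
    proof (rule ccontr)
      assume less: "\<not> ?m x \<le> ?m u"
      then have pos: "?m x > 0"
        using u_pos by simp
      have "1 / (1 + (?m u)\<^sup>2) \<le> (1 - s * ?m u)\<^sup>2 + s\<^sup>2"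
        by (rule ray_loss_lower_bound)
      also have "\<dots> = ls_loss X beta_hat"
        by (simp add: ls_loss_eq beta_u s(2))
      also have "\<dots> \<le> 1 / (1 + (?m x)\<^sup>2)"
        using bound[OF that pos] .
      also have "\<dots> < 1 / (1 + (?m u)\<^sup>2)"
        using less u_pos
        by (intro divide_strict_left_mono) (auto intro!: power_strict_mono mult_pos_pos add_pos_nonneg)
      finally show False
        by simp
    qed
    then show "?m x \<le> ?m ((1 / sqrt (?q beta_hat)) *\<^sub>R beta_hat)" if "x \<in> ?F" for x
      using that by (simp add: u_def s_def)
  qed
qed

end
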